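(* There is no $4$-dimensional dextral symmetric solvable right Leibniz algebra over $\mathbb C$ whose nilradical is isomorphic to $\mu_4$ or $\mu_5$, where $\mu_4$ and $\mu_5$ are the $3$-dimensional Leibniz algebras with basis $\{x,y,z\}$ and non-zero brackets of basis elements $$\mu_4:\ [y,x]=z,\ [x,y]=z;\qquad \mu_5:\ [x,x]=y,\ [y,x]=z.$$
   Context: A right Leibniz algebra over a field $F$ is an $F$-vector space $L$ with a bilinear bracket $[\,,]:L\times L\to L$ satisfying $[a,[b,c]]=[[a,b],c]-[[a,c],b]$ for all $a,b,c\in L$. $L$ is solvable if $L^{[k]}=0$ for some $k\in\mathbb N$, where $L^{[1]}=L$, $L^{[n+1]}=[L^{[n]},L^{[n]}]$ (span of brackets). A Leibniz algebra $N$ is nilpotent (equivalently, right nilpotent) if $N^{<k>}=0$ for some $k$, where $N^{<1>}=N$, $N^{<n+1>}=[N^{<n>},N]$. The nilradical of $L$ is its maximal nilpotent (two-sided) ideal. $L$ is dextral symmetric if for all $a,b,c\in L$, $[a,[b,c]]=0$ implies $[b,[a,c]]=0$. Brackets of basis elements not listed are zero. *)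

theory Defs
  imports "HOL-Analysis.Analysis"
begin

locale right_leibniz_algebra = vector_space scale
  for scale :: "'f::field \<Rightarrow> 'v::ab_group_add \<Rightarrow> 'v" +
  fixes br :: "'v \<Rightarrow> 'v \<Rightarrow> 'v"
  assumes linear_right: "Vector_Spaces.linear scale scale (\<lambda>b. br a b)"
    and linear_left: "Vector_Spaces.linear scale scale (\<lambda>a. br a b)"
    and leibniz: "br a (br b c) = br (br a b) c - br (br a c) b"
begin

definition bracket_span :: "'v set \<Rightarrow> 'v set \<Rightarrow> 'v set" where
  "bracket_span A B = span {br a b | a b. a \<in> A \<and> b \<in> B}"

text \<open>Indexing from 0: \<open>derived_series n\<close> is $L^{[n+1]}$ and
  \<open>lower_central_series N n\<close> is $N^{<n+1>}$.\<close>

primrec derived_series :: "nat \<Rightarrow> 'v set" where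
  "derived_series 0 = UNIV"
| "derived_series (Suc n) = bracket_span (derived_series n) (derived_series n)"

definition solvable :: bool where
  "solvable \<longleftrightarrow> (\<exists>k. derived_series k = {0})"

primrec lower_central_series :: "'v set \<Rightarrow> nat \<Rightarrow> 'v set" where
  "lower_central_series N 0 = N"
| "lower_central_series N (Suc n) = bracket_span (lower_central_series N n) N"

definition nilpotent :: "'v set \<Rightarrow> bool" where
  "nilpotent N \<longleftrightarrow> (\<exists>k. lower_central_series N k = {0})"

definition two_sided_ideal :: "'v set \<Rightarrow> bool" where
  "two_sided_ideal I \<longleftrightarrow> subspace I \<and> (\<forall>a\<in>I. \<forall>b. br a b \<in> I \<and> br b a \<in> I)"

text \<open>Maximal with respect to inclusion. In finite dimension such an ideal is unique,
  but uniqueness is not built into the definition.\<close>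

definition is_nilradical :: "'v set \<Rightarrow> bool" where
  "is_nilradical N \<longleftrightarrow> two_sided_ideal N \<and> nilpotent N \<and>
     (\<forall>I. two_sided_ideal I \<and> nilpotent I \<and> N \<subseteq> I \<longrightarrow> I = N)"

definition dextral_symmetric :: bool where
  "dextral_symmetric \<longleftrightarrow> (\<forall>a b c. br a (br b c) = 0 \<longrightarrow> br b (br a c) = 0)"

text \<open>The subset \<open>N\<close>, with the induced operations, is isomorphic to the algebra
  given by \<open>scale'\<close> and \<open>br'\<close> on a whole type; the isomorphism is taken towards
  \<open>N\<close>, so that it is an everywhere defined linear map.\<close>

definition isomorphic_to ::
  "'v set \<Rightarrow> ('f \<Rightarrow> 'w::ab_group_add \<Rightarrow> 'w) \<Rightarrow> ('w \<Rightarrow> 'w \<Rightarrow> 'w) \<Rightarrow> bool" where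
  "isomorphic_to N scale' br' \<longleftrightarrow>
     (\<exists>f. Vector_Spaces.linear scale' scale f \<and> bij_betw f UNIV N \<and>
          (\<forall>u v. f (br' u v) = br (f u) (f v)))"

end

text \<open>The basis $x, y, z$ is \<open>axis 1 1\<close>, \<open>axis 2 1\<close>, \<open>axis 3 1\<close>; the formulas are the
  bilinear extensions of the multiplication tables, which are checked below.\<close>

definition mu4 :: "complex ^ 3 \<Rightarrow> complex ^ 3 \<Rightarrow> complex ^ 3" where
  "mu4 u v = vector [0, 0, u $ 2 * v $ 1 + u $ 1 * v $ 2]"

definition mu5 :: "complex ^ 3 \<Rightarrow> complex ^ 3 \<Rightarrow> complex ^ 3" where
  "mu5 u v = vector [0, u $ 1 * v $ 1, u $ 2 * v $ 1]"

lemma mu4_table: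
  "mu4 (axis i 1) (axis j 1) =
     (if (i, j) = (2, 1) \<or> (i, j) = (1, 2) then axis 3 1 else 0)"
  using exhaust_3[of i] exhaust_3[of j]
  by (auto simp: mu4_def vec_eq_iff forall_3 axis_def)

lemma mu5_table:
  "mu5 (axis i 1) (axis j 1) =
     (if (i, j) = (1, 1) then axis 2 1 else if (i, j) = (2, 1) then axis 3 1 else 0)"
  using exhaust_3[of i] exhaust_3[of j]
  by (auto simp: mu5_def vec_eq_iff forall_3 axis_def)

lemma right_leibniz_algebra_mu4: "right_leibniz_algebra (*s) mu4"
  by unfold_locales (auto simp: mu4_def vec_eq_iff forall_3 algebra_simps)

lemma right_leibniz_algebra_mu5: "right_leibniz_algebra (*s) mu5"
  by unfold_locales (auto simp: mu5_def vec_eq_iff forall_3 algebra_simps)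

end

theory Submission
  imports Defs
begin

text \<open>Dextral symmetry makes \<open>[a,[b,c]]\<close> an alternating function of its arguments.
  Choose \<open>e\<close> outside the nilradical \<open>N\<close>, so that \<open>L\<close> is spanned by \<open>N\<close> and \<open>e\<close>;
  then \<open>[e,[e,e]] = 0\<close> forces \<open>[e,e] \<in> N\<close>. For \<open>\<mu>\<^sub>5\<close> the identity \<open>[x,[x,v]] = 0\<close> shows
  that \<open>[x,e]\<close>, \<open>[e,x]\<close>, \<open>[e,e]\<close> have no \<open>x\<close>-component. For \<open>\<mu>\<^sub>4\<close> the element
  \<open>[e,[x,y]] = [e,[y,x]]\<close> vanishes, because it is also alternating in \<open>x, y\<close>, and this
  forces all brackets with \<open>e\<close> into the span of \<open>z\<close>. In both cases \<open>L\<close> itself is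
  nilpotent, against the maximality of \<open>N\<close>.\<close>

section \<open>Linear algebra: codimension one and coordinates in small spans\<close>

lemma (in vector_space) extend_by_one:
  assumes "independent B" and "finite B" and "dim UNIV = Suc (card B)"
  obtains e where "e \<notin> span B" and "span (insert e B) = UNIV"
proof -
  define B' where "B' = extend_basis B"
  have B': "B \<subseteq> B'" "independent B'" "span B' = UNIV"
    unfolding B'_def using assms(1)
    by (simp_all add: extend_basis_superset independent_extend_basis)
  have "card B' = Suc (card B)"
    using dim_eq_card[of B' UNIV] B' assms(3) by simp
  \<comment> \<open>Infinite sets have \<open>card\<close> 0, so a successor cardinality gives
    finiteness.\<close>
  then have "finite B'"
    by (intro card_ge_0_finite) simp
  then have "card (B' - B) = 1"
    using \<open>card B' = Suc (card B)\<close> B'(1) assms(2) by (simp add: card_Diff_subset)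
  then obtain e where e: "B' - B = {e}"
    by (rule card_1_singletonE)
  then have eq: "B' = insert e B" and "e \<notin> B"
    using B'(1) by auto
  then have "e \<notin> span B"
    using B'(2) by (simp add: independent_insert)
  then show thesis
    using that eq B'(3) by blast
qed

lemma (in vector_space) span_insert_cases:
  assumes "v \<in> span (insert a S)"
  obtains k w where "v = scale k a + w" and "w \<in> span S"
proof -
  obtain k where "v - scale k a \<in> span S"
    using assms by (auto simp: span_breakdown_eq)
  then show thesis
    using that[of k "v - scale k a"] by simp
qed

lemma (in vector_space) span_pairE:
  assumes "v \<in> span {y, z}"
  obtains b c where "v = scale b y + scale c z"
proof -
  obtain b w where 1: "v = scale b y + w" "w \<in> span {z}"
    using assms by (rule span_insert_cases)
  obtain c where "w = scale c z"
    using 1(2) by (auto simp: span_singleton)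
  then show thesis
    using that 1(1) by simp
qed

lemma (in vector_space) span_tripleE:
  assumes "v \<in> span {x, y, z}"
  obtains a b c where "v = scale a x + scale b y + scale c z"
proof -
  obtain a w where 1: "v = scale a x + w" "w \<in> span {y, z}"
    using assms by (rule span_insert_cases)
  obtain b c where "w = scale b y + scale c z"
    using 1(2) by (rule span_pairE)
  then show thesis
    using that 1(1) by (simp add: add.assoc)
qed

section \<open>Bracket identities and the effect of dextral symmetry\<close>

context right_leibniz_algebra
begin

lemmas br_add_right = module_hom.add[OF Vector_Spaces.linear.axioms(3)[OF linear_right]]
  and br_add_left = module_hom.add[OF Vector_Spaces.linear.axioms(3)[OF linear_left]]
  and br_scale_right = module_hom.scale[OF Vector_Spaces.linear.axioms(3)[OF linear_right]]
  and br_scale_left = module_hom.scale[OF Vector_Spaces.linear.axioms(3)[OF linear_left]]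
  and br_zero_right = module_hom.zero[OF Vector_Spaces.linear.axioms(3)[OF linear_right]]
  and br_zero_left = module_hom.zero[OF Vector_Spaces.linear.axioms(3)[OF linear_left]]
  and br_neg_right = module_hom.neg[OF Vector_Spaces.linear.axioms(3)[OF linear_right]]

lemmas br_simps = br_add_right br_add_left br_scale_right br_scale_left
  br_zero_right br_zero_left br_neg_right

text \<open>The Leibniz identity rearranged: right multiplication by \<open>c\<close> is a
  derivation.\<close>

lemma br_derivation: "br (br a b) c = br (br a c) b + br a (br b c)"
  by (simp add: leibniz)

lemma br_square_right: "br a (br b b) = 0"
  by (simp add: leibniz)

lemma br_skew_right: "br a (br b c) = - br a (br c b)"
  by (simp add: leibniz)

text \<open>The identity [b,[a,a]] = 0 holds in every right Leibniz algebra, so dextral symmetry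
  turns it into [a,[b,a]] = 0; skewness in the inner pair does the rest.\<close>

lemma dextral_symmetric_inner:
  assumes dextral_symmetric
  shows "br a (br a b) = 0"
proof -
  have "br a (br b a) = 0"
    using assms br_square_right unfolding dextral_symmetric_def by blast
  then show ?thesis
    using br_skew_right[of a a b] by simp
qed

text \<open>Polarization of the preceding identity at \<open>a + b\<close>.\<close>

lemma dextral_symmetric_swap:
  assumes dextral_symmetric
  shows "br a (br b c) = - br b (br a c)"
proof -
  have "br (a + b) (br (a + b) c) = 0"
    by (rule dextral_symmetric_inner[OF assms])
  then have "br b (br a c) + br a (br b c) = 0"
    by (simp add: br_add_left br_add_right dextral_symmetric_inner[OF assms])
  then show ?thesis
    by (simp only: eq_neg_iff_add_eq_0 add.commute)
qed

lemma dextral_symmetric_rotate: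
  assumes dextral_symmetric
  shows "br a (br b c) = br c (br a b)"
proof -
  have "br a (br b c) = - br a (br c b)"
    by (rule br_skew_right)
  also have "\<dots> = br c (br a b)"
    using dextral_symmetric_swap[OF assms, of a c b] by simp
  finally show ?thesis .
qed

section \<open>Nilpotency from brackets of generators\<close>

lemma br_span_in_subspace:
  assumes gen: "\<And>a b. a \<in> A \<Longrightarrow> b \<in> B \<Longrightarrow> br a b \<in> S" and S: "subspace S"
    and "a \<in> span A" and "b \<in> span B"
  shows "br a b \<in> S"
proof -
  have right: "br a b \<in> S" if "a \<in> A" for a
    using \<open>b \<in> span B\<close>
  proof (rule span_induct)
    show "subspace {b. br a b \<in> S}"
      using S by (auto simp: subspace_def br_simps)
    show "\<And>b. b \<in> B \<Longrightarrow> br a b \<in> S"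
      using gen that by blast
  qed
  show ?thesis
    using \<open>a \<in> span A\<close>
  proof (rule span_induct)
    show "subspace {a. br a b \<in> S}"
      using S by (auto simp: subspace_def br_simps)
  qed (fact right)
qed

lemma bracket_span_subset_span:
  assumes "\<And>a b. a \<in> A \<Longrightarrow> b \<in> B \<Longrightarrow> br a b \<in> span S"
    and "A' \<subseteq> span A" and "B' \<subseteq> span B"
  shows "bracket_span A' B' \<subseteq> span S"
proof -
  have "br a b \<in> span S" if "a \<in> A'" "b \<in> B'" for a b
    using assms(1) subspace_span
  proof (rule br_span_in_subspace)
    show "a \<in> span A" and "b \<in> span B"
      using that assms(2,3) by auto
  qed
  then show ?thesis
    unfolding bracket_span_def by (intro span_minimal) auto
qed

lemma zero_in_lower_central_series:
  "0 \<in> lower_central_series UNIV n"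
  by (cases n) (simp_all add: bracket_span_def span_zero)

text \<open>Reduces nilpotency to finitely many brackets of generators: right multiplication by L
  descends along L, \<open>span A\<close>, \<open>span B\<close>, 0. With indexing from 0, the term
  that vanishes is number 3.\<close>

lemma two_step_nilpotent:
  assumes "span G = UNIV"
    and "\<And>a b. a \<in> G \<Longrightarrow> b \<in> G \<Longrightarrow> br a b \<in> span A"
    and "\<And>a b. a \<in> A \<Longrightarrow> b \<in> G \<Longrightarrow> br a b \<in> span B"
    and "\<And>a b. a \<in> B \<Longrightarrow> b \<in> G \<Longrightarrow> br a b = 0"
  shows "nilpotent UNIV"
proof -
  let ?C = "lower_central_series UNIV"
  have "?C 1 \<subseteq> span A"
    using bracket_span_subset_span[of G G A UNIV UNIV] assms(1,2) by simp
  then have "?C 2 \<subseteq> span B"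
    using bracket_span_subset_span[of A G B "?C 1" UNIV] assms(1,3)
    by (simp add: numeral_2_eq_2)
  then have "?C 3 \<subseteq> span {}"
    using bracket_span_subset_span[of B G "{}" "?C 2" UNIV] assms(1,4)
    by (simp add: numeral_3_eq_3 numeral_2_eq_2)
  then have "?C 3 = {0}"
    using zero_in_lower_central_series[of 3] by auto
  then show ?thesis
    unfolding nilpotent_def by blast
qed

section \<open>Nilradicals of codimension one\<close>

lemma nilradical_of_nilpotent:
  assumes "is_nilradical N" and "nilpotent UNIV"
  shows "N = UNIV"
proof -
  have "two_sided_ideal UNIV"
    unfolding two_sided_ideal_def by simp
  then show ?thesis
    using assms unfolding is_nilradical_def by blast
qed

text \<open>Write [e,e] = ke + n with n in the ideal. Left multiplication by e kills the square, so
  k[e,e] = -[e,n] lies in the ideal; either k = 0 and [e,e] = n, or one divides by k.\<close>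

lemma square_mem_codim_one_ideal:
  assumes ideal: "two_sided_ideal (span B)" and e: "e \<notin> span B" and sp: "span (insert e B) = UNIV"
  shows "br e e \<in> span B"
proof -
  obtain k n where k: "br e e = scale k e + n" and n: "n \<in> span B"
    using sp span_insert_cases[of "br e e" e B] by blast
  have "br e (br e e) = 0"
    by (rule br_square_right)
  then have "scale k (br e e) + br e n = 0"
    unfolding k by (simp add: br_simps k)
  then have "scale k (br e e) = - br e n"
    by (simp add: eq_neg_iff_add_eq_0)
  also have "\<dots> \<in> span B"
    using ideal n unfolding two_sided_ideal_def by (simp add: span_neg)
  finally have scaled: "scale k (br e e) \<in> span B" .
  have "k = 0 \<or> br e e \<in> span B"
    using span_scale[OF scaled, of "inverse k"] by (cases "k = 0") simp_all
  then show ?thesis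
    using k n by auto
qed

lemma nilradical_codim_one:
  assumes "is_nilradical (span B)" and "independent B" and "finite B"
    and "dim UNIV = Suc (card B)"
  obtains e where "span (insert e B) = UNIV" and "\<not> nilpotent UNIV"
    and "\<And>u. u \<in> insert e B \<Longrightarrow> br u e \<in> span B"
    and "\<And>u. u \<in> insert e B \<Longrightarrow> br e u \<in> span B"
proof -
  obtain e where e: "e \<notin> span B" and sp: "span (insert e B) = UNIV"
    using extend_by_one[OF assms(2-4)] .
  have ideal: "two_sided_ideal (span B)"
    using assms(1) unfolding is_nilradical_def by blast
  have ee: "br e e \<in> span B"
    using square_mem_codim_one_ideal[OF ideal e sp] .
  \<comment> \<open>Otherwise maximality would make the nilradical everything, including
    \<open>e\<close>.\<close>
  have "\<not> nilpotent UNIV"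
    using nilradical_of_nilpotent[OF assms(1)] e by auto
  moreover have "br u e \<in> span B \<and> br e u \<in> span B" if "u \<in> insert e B" for u
    using that ee ideal span_base[of u B] unfolding two_sided_ideal_def by auto
  ultimately show thesis
    using that sp by blast
qed

section \<open>The nilradical of type \<open>mu4\<close>\<close>

lemma no_nilradical_mu4:
  assumes char: "(2::'f) \<noteq> 0" and ds: dextral_symmetric and dim: "dim UNIV = 4"
    and nilrad: "is_nilradical (span {x, y, z})"
    and indep: "independent {x, y, z}" and card: "card {x, y, z} = 3"
    and table: "br x x = 0" "br x y = z" "br x z = 0" "br y x = z" "br y y = 0" "br y z = 0"
      "br z x = 0" "br z y = 0" "br z z = 0"
  shows False
proof -
  have "z \<noteq> 0"
    using indep dependent_zero[of "{x, y, z}"] by auto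
  obtain e where sp: "span (insert e {x, y, z}) = UNIV" and not_nil: "\<not> nilpotent UNIV"
    and right: "\<And>u. u \<in> {e, x, y, z} \<Longrightarrow> br u e \<in> span {x, y, z}"
    and left: "\<And>u. u \<in> {e, x, y, z} \<Longrightarrow> br e u \<in> span {x, y, z}"
    using nilradical_codim_one[OF nilrad indep] dim card by auto
  \<comment> \<open>For n = ax + by + cz the table gives [x,n] = bz and [y,n] = az.\<close>
  have central: "n \<in> span {z}"
    if "n \<in> span {x, y, z}" "br x n = 0" "br y n = 0" for n
  proof -
    obtain a b c where n: "n = scale a x + scale b y + scale c z"
      using span_tripleE \<open>n \<in> span {x, y, z}\<close> by blast
    then have "b = 0" "a = 0"
      using that(2,3) table \<open>z \<noteq> 0\<close> by (simp_all add: br_simps)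
    then show ?thesis
      using n by (simp add: span_base span_scale)
  qed
  \<comment> \<open>Both [x,y] and [y,x] equal z, while [e,[x,y]] changes sign under swapping x and
    y; hence 2[e,z] = 0.\<close>
  have "br e z = - br e z"
    using br_skew_right[of e x y] unfolding table .
  then have "br e z + br e z = 0"
    by (rule eq_neg_iff_add_eq_0[THEN iffD1])
  then have "scale (1 + 1) (br e z) = 0"
    unfolding scale_left_distrib scale_one .
  then have ez: "br e z = 0"
    using char by (simp only: one_add_one scale_eq_0_iff) simp
  have outer: "br x (br x v) = 0" "br y (br y v) = 0" for v
    by (rule dextral_symmetric_inner[OF ds])+
  \<comment> \<open>A cyclic rotation carries both to [e,z].\<close>
  have cross: "br x (br y e) = 0" "br y (br x e) = 0"
    using dextral_symmetric_rotate[OF ds, of x y e] dextral_symmetric_rotate[OF ds, of y x e] ez table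
    by simp_all
  have cross': "br x (br e y) = 0" "br y (br e x) = 0"
    using cross br_skew_right[of x e y] br_skew_right[of y e x] by simp_all
  have outer': "br x (br e x) = 0" "br y (br e y) = 0"
    using outer br_skew_right[of x e x] br_skew_right[of y e y] by simp_all
  have "br x e \<in> span {z}" "br y e \<in> span {z}" "br e x \<in> span {z}" "br e y \<in> span {z}"
    "br e e \<in> span {z}"
    using right left outer cross cross' outer' br_square_right by (simp_all add: central)
  moreover have "br z e = 0"
  proof -
    have "br w y = 0" if "w \<in> span {z}" for w
      using that table by (auto simp: span_singleton br_simps)
    then have "br (br x e) y = 0"
      using \<open>br x e \<in> span {z}\<close> by blast
    \<comment> \<open>Differentiate z = [x,y] by e: [z,e] = [[x,e],y] + [x,[y,e]], and both terms
      vanish.\<close>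
    then show ?thesis
      using br_derivation[of x y e] cross table by simp
  qed
  ultimately have "nilpotent UNIV"
    using table ez
    by (intro two_step_nilpotent[OF sp, of "{z}" "{}"])
      (auto simp: span_zero intro: span_base)
  then show False
    using not_nil by contradiction
qed

section \<open>The nilradical of type \<open>mu5\<close>\<close>

lemma no_nilradical_mu5:
  assumes ds: dextral_symmetric and dim: "dim UNIV = 4"
    and nilrad: "is_nilradical (span {x, y, z})"
    and indep: "independent {x, y, z}" and card: "card {x, y, z} = 3"
    and table: "br x x = y" "br x y = 0" "br x z = 0" "br y x = z" "br y y = 0" "br y z = 0"
      "br z x = 0" "br z y = 0" "br z z = 0"
  shows False
proof -
  have "y \<noteq> 0"
    using indep dependent_zero[of "{x, y, z}"] by auto
  obtain e where sp: "span (insert e {x, y, z}) = UNIV" and not_nil: "\<not> nilpotent UNIV"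
    and right: "\<And>u. u \<in> {e, x, y, z} \<Longrightarrow> br u e \<in> span {x, y, z}"
    and left: "\<And>u. u \<in> {e, x, y, z} \<Longrightarrow> br e u \<in> span {x, y, z}"
    using nilradical_codim_one[OF nilrad indep] dim card by auto
  \<comment> \<open>Left multiplication by x sends n = ax + by + cz to ay.\<close>
  have annihilator: "n \<in> span {y, z}"
    if "n \<in> span {x, y, z}" "br x n = 0" for n
  proof -
    obtain a b c where n: "n = scale a x + scale b y + scale c z"
      using span_tripleE \<open>n \<in> span {x, y, z}\<close> by blast
    then have "a = 0"
      using that(2) table \<open>y \<noteq> 0\<close> by (simp add: br_simps)
    then show ?thesis
      using n by (simp add: span_base span_scale span_add)
  qed
  have xxe: "br x (br x e) = 0"
    by (rule dextral_symmetric_inner[OF ds])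
  then have "br x (br e x) = 0"
    using br_skew_right[of x e x] by simp
  with xxe have mem: "br x e \<in> span {y, z}" "br e x \<in> span {y, z}" "br e e \<in> span {y, z}"
    using right left br_square_right by (simp_all add: annihilator)
  have yz: "br w x \<in> span {z}" "br w y = 0" "br u w = 0"
    if "w \<in> span {y, z}" "u \<in> {x, y, z}" for u w
  proof -
    obtain b c where "w = scale b y + scale c z"
      using span_pairE \<open>w \<in> span {y, z}\<close> by blast
    then show "br w x \<in> span {z}" "br w y = 0" "br u w = 0"
      using table that(2) by (auto simp: br_simps span_base span_scale)
  qed
  \<comment> \<open>Here y is the square [x,x].\<close>
  have ey: "br e y = 0"
    using br_square_right[of e x] table by simp
  \<comment> \<open>Differentiate y = [x,x] by e: the term [x,[x,e]] vanishes, and [[x,e],x] is a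
    multiple of z.\<close>
  have ye: "br y e \<in> span {z}"
    using br_derivation[of x x e] xxe table yz(1)[OF mem(1), of x] by simp
  have ze: "br z e = 0"
  proof -
    have "br (br y e) x = 0"
      using ye table by (auto simp: span_singleton br_simps)
    \<comment> \<open>Now differentiate z = [y,x] by e.\<close>
    then show ?thesis
      using br_derivation[of y x e] yz(3)[OF mem(1), of y] table by simp
  qed
  have ez: "br e z = 0"
    using leibniz[of e y x] yz(2)[OF mem(2), of x] ey table by (simp add: br_simps)
  have "span {z} \<subseteq> span {y, z}"
    by (rule span_mono) simp
  \<comment> \<open>The descending chain is L, \<open>span {y, z}\<close>, \<open>span {z}\<close>,
    0.\<close>
  then have "nilpotent UNIV"
    using table mem ey ye ze ez
    by (intro two_step_nilpotent[OF sp, of "{y, z}" "{z}"])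
      (auto simp: span_zero intro: span_base)
  then show False
    using not_nil by contradiction
qed

section \<open>Transfer from the coordinate models\<close>

lemma isomorphic_to_basis:
  fixes br' :: "'f ^ 3 \<Rightarrow> 'f ^ 3 \<Rightarrow> 'f ^ 3"
  assumes "isomorphic_to N (*s) br'"
  obtains f where "Vector_Spaces.linear (*s) scale f"
    and "N = span {f (axis 1 1), f (axis 2 1), f (axis 3 1)}"
    and "independent {f (axis 1 1), f (axis 2 1), f (axis 3 1)}"
    and "card {f (axis 1 1), f (axis 2 1), f (axis 3 1)} = 3"
    and "\<And>u v. br (f u) (f v) = f (br' u v)"
proof -
  obtain f where lin: "Vector_Spaces.linear (*s) scale f" and bij: "bij_betw f UNIV N"
    and hom: "\<And>u v. br (f u) (f v) = f (br' u v)"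
    using assms unfolding isomorphic_to_def by metis
  interpret f: Vector_Spaces.linear "(*s)" scale f
    by (rule lin)
  interpret pair: vector_space_pair "(*s) :: 'f \<Rightarrow> 'f ^ 3 \<Rightarrow> 'f ^ 3" scale ..
  have inj: "inj f" and range: "range f = N"
    using bij by (auto simp: bij_betw_def)
  \<comment> \<open>An injective linear map carries the standard basis to a basis of its range, here
    N.\<close>
  have image: "f ` cart_basis = {f (axis 1 1), f (axis 2 1), f (axis 3 1)}"
    unfolding cart_basis_def Setcompr_eq_image UNIV_3 by simp
  have "span (f ` cart_basis) = N"
    using f.span_image[of cart_basis] range by simp
  moreover have "independent (f ` cart_basis)"
    using pair.linear_independent_injective_image[OF lin independent_cart_basis] inj by simp
  moreover have "card (f ` cart_basis) = 3"
    using card_image[OF inj_on_subset[OF inj subset_UNIV], of cart_basis]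
    by (simp add: card_cart_basis)
  ultimately show thesis
    using that lin hom unfolding image by blast
qed

end

theorem proposition5p11:
  "\<not> (\<exists>(scale :: complex \<Rightarrow> 'a::ab_group_add \<Rightarrow> 'a) (br :: 'a \<Rightarrow> 'a \<Rightarrow> 'a) (N :: 'a set).
        right_leibniz_algebra scale br \<and>
        vector_space.dim scale UNIV = 4 \<and>
        right_leibniz_algebra.dextral_symmetric br \<and>
        right_leibniz_algebra.solvable scale br \<and>
        right_leibniz_algebra.is_nilradical scale br N \<and>
        (right_leibniz_algebra.isomorphic_to scale br N (*s) mu4 \<or>
         right_leibniz_algebra.isomorphic_to scale br N (*s) mu5))"
proof clarify
  fix scale :: "complex \<Rightarrow> 'a::ab_group_add \<Rightarrow> 'a" and br :: "'a \<Rightarrow> 'a \<Rightarrow> 'a" and N :: "'a set"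
  assume L: "right_leibniz_algebra scale br"
    and dim: "vector_space.dim scale UNIV = 4"
    and ds: "right_leibniz_algebra.dextral_symmetric br"
    and nilrad: "right_leibniz_algebra.is_nilradical scale br N"
    and iso: "right_leibniz_algebra.isomorphic_to scale br N (*s) mu4 \<or>
         right_leibniz_algebra.isomorphic_to scale br N (*s) mu5"
  interpret right_leibniz_algebra scale br
    by (rule L)
  from iso show False
  proof
    assume "isomorphic_to N (*s) mu4"
    then obtain f where "Vector_Spaces.linear (*s) scale f"
      and f: "N = span {f (axis 1 1), f (axis 2 1), f (axis 3 1)}"
        "independent {f (axis 1 1), f (axis 2 1), f (axis 3 1)}"
        "card {f (axis 1 1), f (axis 2 1), f (axis 3 1)} = 3"
      and hom: "\<And>u v. br (f u) (f v) = f (mu4 u v)"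
      by (rule isomorphic_to_basis) blast
    then interpret f: Vector_Spaces.linear "(*s)" scale f
      by simp
    \<comment> \<open>The map \<open>f\<close> is linear and multiplicative, so it carries the table
      of \<open>mu4\<close> to N. The open premise is 2 \<noteq> 0 in the complex numbers.\<close>
    show False
      by (rule no_nilradical_mu4[OF _ ds dim nilrad[unfolded f(1)] f(2,3)])
        (simp_all add: hom mu4_table)
  next
    assume "isomorphic_to N (*s) mu5"
    then obtain f where "Vector_Spaces.linear (*s) scale f"
      and f: "N = span {f (axis 1 1), f (axis 2 1), f (axis 3 1)}"
        "independent {f (axis 1 1), f (axis 2 1), f (axis 3 1)}"
        "card {f (axis 1 1), f (axis 2 1), f (axis 3 1)} = 3"
      and hom: "\<And>u v. br (f u) (f v) = f (mu5 u v)"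
      by (rule isomorphic_to_basis) blast
    then interpret f: Vector_Spaces.linear "(*s)" scale f
      by simp
    show False
      by (rule no_nilradical_mu5[OF ds dim nilrad[unfolded f(1)] f(2,3)])
        (simp_all add: hom mu5_table)
  qed
qed

end
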